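(* Consider the bi-type binary Galton-Watson tree with parameters $p_0,p_{bb},p_{rr},p_{br}$ and $q_0,q_{bb},q_{rr},q_{br}$ described in the context. (a) Normal game: for each $i=1,2$, $\mathrm{nd}_{i,b}=\mathrm{nd}_{i,r}=1$ if $p_{br}=q_{br}=1$, and $\mathrm{nd}_{i,b}=\mathrm{nd}_{i,r}=0$ otherwise. (b) Misère game: for each $i=1,2$, $\mathrm{md}_{i,b}=\mathrm{md}_{i,r}=1$ if $p_{br}=q_{br}=1$, and $\mathrm{md}_{i,b}=\mathrm{md}_{i,r}=0$ otherwise. (c) Escape game: $\mathrm{esl}_b=\mathrm{esl}_r=1$ if $p_{br}=q_{br}=1$, and $\mathrm{esl}_b=\mathrm{esl}_r=0$ otherwise.
   Context: Tree. Vertices are coloured blue ($b$) or red ($r$); $\sigma(v)$ is the colour of $v$. The rooted tree is a two-type Galton-Watson tree with root $\phi$, every vertex reproducing independently of all else as follows. A vertex of colour $b$ has no child with probability $p_0$, two blue children with probability $p_{bb}$, two red children with probability $p_{rr}$, and one red and one blue child with probability $p_{br}$ (non-negative numbers with $p_0+p_{bb}+p_{rr}+p_{br}=1$). A vertex of colour $r$ has no child with probability $q_0$, two blue children with probability $q_{bb}$, two red children with probability $q_{rr}$, and one red and one blue child with probability $q_{br}$ (non-negative numbers with $q_0+q_{bb}+q_{rr}+q_{br}=1$). Edges $(u,v)$ are directed from parent $u$ to child $v$. Games. P1 and Stopper may move only along monochromatic directed edges ($\sigma(u)=\sigma(v)$); P2 and Escaper may move only along non-monochromatic directed edges ($\sigma(u)\ne\sigma(v)$).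 A token is placed on an initial vertex, and the two players alternately move it along a directed edge permissible for the player whose turn it is. Normal game (P1 vs P2): the first player unable to move loses. Misère game (P1 vs P2): the first player unable to move wins. In both, if no player is ever unable to move, the game is a draw. Escape game (Stopper vs Escaper): if either player is ever unable to move, Stopper wins; otherwise Escaper wins. Outcomes are those under optimal play. Probabilities. For $i=1,2$ and $j\in\{b,r\}$, conditioned on $\sigma(\phi)=j$: $\mathrm{nd}_{i,j}$ (resp. $\mathrm{md}_{i,j}$) is the probability that the normal (resp. misère) game with initial vertex $\phi$ and P$i$ playing the first round is a draw; $\mathrm{esl}_j$ is the probability that Stopper loses (i.e. Escaper wins) the escape game with initial vertex $\phi$ when Stopper plays the first round. *)

theory Defs
  imports "HOL-Probability.Probability"
begin

section \<open>The bi-type binary Galton--Watson tree\<close>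

datatype colour = Blue | Red

datatype brood = No_Child | Two_Blue | Two_Red | One_Each

text \<open>
  Vertices are words over the two child slots. The most recent step comes first, so the root is
  the empty list and the potential children of \<open>u\<close> are \<open>False # u\<close> and \<open>True # u\<close>. A coloured
  tree maps the words that are vertices of the tree to their colour, all others to \<open>None\<close>.
\<close>

type_synonym vertex = "bool list"
type_synonym tree = "vertex \<Rightarrow> colour option"

fun child_colour :: "brood \<Rightarrow> bool \<Rightarrow> colour option" where
  "child_colour No_Child i = None"
| "child_colour Two_Blue i = Some Blue"
| "child_colour Two_Red i = Some Red"
| "child_colour One_Each i = Some (if i then Red else Blue)"

text \<open>
  The arguments of \<open>brood_law\<close> are the probabilities of no child, two blue children, two red
  children, and one child of each colour, in this order.
\<close>

definition brood_law :: "real \<Rightarrow> real \<Rightarrow> real \<Rightarrow> real \<Rightarrow> brood pmf" where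
  "brood_law a0 abb arr abr = embed_pmf (\<lambda>x. case x of
     No_Child \<Rightarrow> a0 | Two_Blue \<Rightarrow> abb | Two_Red \<Rightarrow> arr | One_Each \<Rightarrow> abr)"

lemma UNIV_brood: "(UNIV :: brood set) = {No_Child, Two_Blue, Two_Red, One_Each}"
  using brood.exhaust by auto

lemma pmf_brood_law:
  assumes "a0 \<ge> 0" "abb \<ge> 0" "arr \<ge> 0" "abr \<ge> 0" "a0 + abb + arr + abr = 1"
  shows "pmf (brood_law a0 abb arr abr) x = (case x of
     No_Child \<Rightarrow> a0 | Two_Blue \<Rightarrow> abb | Two_Red \<Rightarrow> arr | One_Each \<Rightarrow> abr)"
  unfolding brood_law_def
proof (rule pmf_embed_pmf)
  show "0 \<le> (case x of No_Child \<Rightarrow> a0 | Two_Blue \<Rightarrow> abb | Two_Red \<Rightarrow> arr | One_Each \<Rightarrow> abr)" for x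
    using assms by (cases x) auto
  show "(\<integral>\<^sup>+ x. ennreal (case x of
      No_Child \<Rightarrow> a0 | Two_Blue \<Rightarrow> abb | Two_Red \<Rightarrow> arr | One_Each \<Rightarrow> abr) \<partial>count_space UNIV) = 1"
    using assms by (subst nn_integral_count_space_finite)
      (auto simp: UNIV_brood ennreal_plus[symmetric] add.assoc simp del: ennreal_plus)
qed

text \<open>
  A sample point consists of the colour of the root, with law \<open>rho\<close>, and of a brood for every
  pair of a potential vertex and a potential colour of it, with law \<open>K c\<close> for the colour \<open>c\<close>;
  all of these are independent. A vertex of colour \<open>c\<close> reproduces according to the brood stored
  for \<open>c\<close>; the other one is ignored.
\<close>

type_synonym sample = "colour \<times> (vertex \<times> colour \<Rightarrow> brood)"

definition gw_space :: "colour pmf \<Rightarrow> (colour \<Rightarrow> brood pmf) \<Rightarrow> sample measure" where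
  "gw_space rho K =
     measure_pmf rho \<Otimes>\<^sub>M (\<Pi>\<^sub>M x\<in>UNIV. measure_pmf (K (snd x)))"

primrec gw_tree :: "sample \<Rightarrow> tree" where
  "gw_tree \<omega> [] = Some (fst \<omega>)"
| "gw_tree \<omega> (i # u) = (case gw_tree \<omega> u of
     None \<Rightarrow> None
   | Some c \<Rightarrow> child_colour (snd \<omega> (u, c)) i)"


section \<open>The games\<close>

text \<open>In the escape game Stopper is \<open>P1\<close> and Escaper is \<open>P2\<close>.\<close>

datatype player = P1 | P2

fun opponent :: "player \<Rightarrow> player" where
  "opponent P1 = P2"
| "opponent P2 = P1"

definition edge :: "tree \<Rightarrow> vertex \<Rightarrow> vertex \<Rightarrow> bool" where
  "edge t u v \<longleftrightarrow> t u \<noteq> None \<and> t v \<noteq> None \<and> (\<exists>i. v = i # u)"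

definition legal :: "tree \<Rightarrow> player \<Rightarrow> vertex \<Rightarrow> vertex \<Rightarrow> bool" where
  "legal t P u v \<longleftrightarrow> edge t u v \<and> (case P of P1 \<Rightarrow> t u = t v | P2 \<Rightarrow> t u \<noteq> t v)"

definition stuck :: "tree \<Rightarrow> player \<Rightarrow> vertex \<Rightarrow> bool" where
  "stuck t P u \<longleftrightarrow> (\<nexists>v. legal t P u v)"

text \<open>
  A strategy may be taken to depend on the current vertex only: in a tree the current vertex
  determines the whole history of the play.
\<close>

type_synonym strategy = "vertex \<Rightarrow> vertex"

definition is_strategy :: "tree \<Rightarrow> player \<Rightarrow> strategy \<Rightarrow> bool" where
  "is_strategy t P s \<longleftrightarrow> (\<forall>u. \<not> stuck t P u \<longrightarrow> legal t P u (s u))"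

text \<open>\<open>mover i n\<close> makes the move of round \<open>n\<close> (counted from 0) if \<open>i\<close> plays the first round.\<close>

definition mover :: "player \<Rightarrow> nat \<Rightarrow> player" where
  "mover i n = (if even n then i else opponent i)"

text \<open>The values of \<open>play\<close> are meaningful only up to the first round with a stuck mover.\<close>

primrec play :: "player \<Rightarrow> vertex \<Rightarrow> (player \<Rightarrow> strategy) \<Rightarrow> nat \<Rightarrow> vertex" where
  "play i x S 0 = x"
| "play i x S (Suc n) = S (mover i n) (play i x S n)"

definition stuck_at :: "tree \<Rightarrow> player \<Rightarrow> vertex \<Rightarrow> (player \<Rightarrow> strategy) \<Rightarrow> nat \<Rightarrow> bool" where
  "stuck_at t i x S n \<longleftrightarrow> stuck t (mover i n) (play i x S n)"

text \<open>The first player unable to move, or \<open>None\<close> if the play goes on for ever.\<close>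

definition first_stuck ::
    "tree \<Rightarrow> player \<Rightarrow> vertex \<Rightarrow> (player \<Rightarrow> strategy) \<Rightarrow> player option" where
  "first_stuck t i x S =
     (if \<exists>n. stuck_at t i x S n then Some (mover i (LEAST n. stuck_at t i x S n)) else None)"

text \<open>
  A game is given by the winning condition \<open>W P r\<close>: player \<open>P\<close> wins every play in which \<open>r\<close> is
  the first player unable to move.
\<close>

type_synonym game = "player \<Rightarrow> player option \<Rightarrow> bool"

definition normal :: game where
  "normal P r \<longleftrightarrow> r = Some (opponent P)"

definition misere :: game where
  "misere P r \<longleftrightarrow> r = Some P"

definition escape :: game where
  "escape P r \<longleftrightarrow> (case P of P1 \<Rightarrow> r \<noteq> None | P2 \<Rightarrow> r = None)"

definition wins :: "game \<Rightarrow> tree \<Rightarrow> player \<Rightarrow> vertex \<Rightarrow> player \<Rightarrow> bool" where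
  "wins W t i x P \<longleftrightarrow> (\<exists>s. is_strategy t P s \<and>
     (\<forall>s'. is_strategy t (opponent P) s' \<longrightarrow>
        W P (first_stuck t i x (\<lambda>Q. if Q = P then s else s'))))"

definition draw :: "game \<Rightarrow> tree \<Rightarrow> player \<Rightarrow> vertex \<Rightarrow> bool" where
  "draw W t i x \<longleftrightarrow> (\<forall>P. \<not> wins W t i x P)"


section \<open>Probabilities of the outcomes\<close>

definition nd :: "sample measure \<Rightarrow> player \<Rightarrow> colour \<Rightarrow> real" where
  "nd M i j = cond_prob M (\<lambda>\<omega>. draw normal (gw_tree \<omega>) i []) (\<lambda>\<omega>. gw_tree \<omega> [] = Some j)"

definition md :: "sample measure \<Rightarrow> player \<Rightarrow> colour \<Rightarrow> real" where
  "md M i j = cond_prob M (\<lambda>\<omega>. draw misere (gw_tree \<omega>) i []) (\<lambda>\<omega>. gw_tree \<omega> [] = Some j)"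

definition esl :: "sample measure \<Rightarrow> colour \<Rightarrow> real" where
  "esl M j = cond_prob M (\<lambda>\<omega>. wins escape (gw_tree \<omega>) P1 [] P2) (\<lambda>\<omega>. gw_tree \<omega> [] = Some j)"

end

theory Submission
  imports Defs
begin

text \<open>
  A draw, or a win of Escaper, requires an infinite play: if all plays have at most \<open>n\<close> moves, then
  backward induction gives one of the players a win, and in the escape game it gives Stopper a win
  (\<open>forces_if_not_survives\<close>). So it suffices to decide when an infinite play exists at all, that
  is, when both players together could move the token for ever.

  The positions that can be reached from the root form a branching process. The type of a position is the
  pair of the player to move and the colour of the vertex, and all children of a position have the same type,
  because \<open>P1\<close> keeps the colour and \<open>P2\<close> changes it. The four types follow one another in the cyclic order
  \<open>(P1, Blue)\<close>, \<open>(P2, Blue)\<close>, \<open>(P1, Red)\<close>, \<open>(P2, Red)\<close>, and their mean numbers of children are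
  \<open>pbr + 2 pbb\<close>, \<open>pbr + 2 prr\<close>, \<open>qbr + 2 qrr\<close> and \<open>qbr + 2 qbb\<close>. By the inequality of arithmetic and
  geometric means the first two have product at most \<open>(pbr + pbb + prr)\<^sup>2 \<le> 1\<close>, and likewise the last two.
  The process is therefore subcritical or critical over one turn of the cycle, and it dies out almost surely
  unless every position has exactly one child, which means \<open>pbr = qbr = 1\<close>. In the formal proof
  extinction is read off from the fixed point equations of the survival probabilities
  (\<open>survival_Suc\<close>, \<open>cyclic_system_zero\<close>), and \<open>prob_survives\<close> identifies these probabilities.

  If \<open>pbr = qbr = 1\<close>, then almost surely every vertex has a child of each colour, nobody is ever stuck, and
  every play is infinite. To conclude that the outcome has probability 1, one must know that it is
  an event. This follows from determinacy: by \<open>wins_iff_forces\<close> a player wins if and only if some finite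
  number of moves suffices, and such a win depends on finitely many vertices.
\<close>


section \<open>Determinacy of the games\<close>

text \<open>
  All objectives except that of Escaper are reachability objectives: the play has to stop, and the first stuck
  player has to belong to a given set \<open>T\<close>. The backward induction \<open>forces t T P n Q u\<close> expresses that \<open>P\<close> can
  achieve this from \<open>u\<close>, with \<open>Q\<close> to move, within a budget of \<open>n\<close> further moves of both players.
\<close>

primrec forces :: "tree \<Rightarrow> player set \<Rightarrow> player \<Rightarrow> nat \<Rightarrow> player \<Rightarrow> vertex \<Rightarrow> bool" where
  "forces t T P 0 Q u \<longleftrightarrow> stuck t Q u \<and> Q \<in> T"
| "forces t T P (Suc n) Q u \<longleftrightarrow>
     (if stuck t Q u then Q \<in> T
      else if Q = P then \<exists>v. legal t Q u v \<and> forces t T P n (opponent Q) v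
      else \<forall>v. legal t Q u v \<longrightarrow> forces t T P n (opponent Q) v)"

lemma opponent_opponent [simp]: "opponent (opponent P) = P"
  by (cases P) auto

lemma neq_opponent_iff: "Q \<noteq> opponent P \<longleftrightarrow> Q = P" "Q \<noteq> P \<longleftrightarrow> Q = opponent P"
  by (cases P; cases Q; simp)+

lemma opponent_neq [simp]: "opponent P \<noteq> P" "P \<noteq> opponent P"
  by (cases P; simp)+

lemma Compl_player: "- {P} = {opponent P}"
  by (auto simp: neq_opponent_iff)

lemma if_player_swap: "(if Q = P1 then a else b) = (if Q = P2 then b else a)"
  by (cases Q) simp_all

lemma mover_Suc: "mover i (Suc n) = opponent (mover i n)"
  by (simp add: mover_def)

lemma forces_Suc_mono: "forces t T P n Q u \<Longrightarrow> forces t T P (Suc n) Q u"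
proof (induction n arbitrary: Q u)
  case 0
  then show ?case by simp
next
  case (Suc n)
  show ?case
    unfolding forces.simps(2)[of t T P "Suc n"]
    using Suc.prems[unfolded forces.simps(2)] Suc.IH
    by (auto simp del: forces.simps split: if_splits)
qed

lemma forces_mono: "m \<le> n \<Longrightarrow> forces t T P m Q u \<Longrightarrow> forces t T P n Q u"
  by (induction rule: dec_induct) (auto simp del: forces.simps intro: forces_Suc_mono)

lemma first_stuck_eq_Some_iff:
  "first_stuck t i x S = Some R \<longleftrightarrow>
     (\<exists>m. stuck_at t i x S m \<and> (\<forall>j<m. \<not> stuck_at t i x S j) \<and> R = mover i m)"
proof
  assume *: "first_stuck t i x S = Some R"
  then have ex: "\<exists>n. stuck_at t i x S n" by (auto simp: first_stuck_def split: if_splits)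
  with * have "R = mover i (LEAST n. stuck_at t i x S n)" by (simp add: first_stuck_def)
  with LeastI_ex[OF ex] not_less_Least[of _ "stuck_at t i x S"]
  show "\<exists>m. stuck_at t i x S m \<and> (\<forall>j<m. \<not> stuck_at t i x S j) \<and> R = mover i m" by blast
next
  assume "\<exists>m. stuck_at t i x S m \<and> (\<forall>j<m. \<not> stuck_at t i x S j) \<and> R = mover i m"
  then obtain m where m: "stuck_at t i x S m" "\<And>j. j < m \<Longrightarrow> \<not> stuck_at t i x S j" "R = mover i m"
    by blast
  then have "(LEAST n. stuck_at t i x S n) = m"
    by (intro Least_equality) (auto simp: not_less[symmetric])
  with m show "first_stuck t i x S = Some R" by (auto simp: first_stuck_def)
qed

text \<open>
  One strategy has to serve all budgets at once. Out of a position with a winning budget it moves to a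
  child that wins with one move less than the least such budget; by monotonicity the child then wins
  with one move less than any winning budget, so the budget decreases along every play.
\<close>

lemma forces_imp_strategy:
  assumes "forces t T P n i x"
  shows "\<exists>s. is_strategy t P s \<and> (\<forall>s'. is_strategy t (opponent P) s' \<longrightarrow>
    (\<exists>R\<in>T. first_stuck t i x (\<lambda>Q. if Q = P then s else s') = Some R))"
proof -
  define good where "good u v \<longleftrightarrow> legal t P u v \<and>
    (\<forall>n. forces t T P (Suc n) P u \<longrightarrow> forces t T P n (opponent P) v)" for u v
  have ex: "\<exists>v. good u v" if u: "\<not> stuck t P u" for u
  proof (cases "\<exists>n. forces t T P (Suc n) P u")
    case True
    define k where "k = (LEAST n. forces t T P (Suc n) P u)"
    have "forces t T P (Suc k) P u" unfolding k_def by (rule LeastI_ex[OF True])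
    with u obtain v where "legal t P u v" "forces t T P k (opponent P) v" by auto
    moreover have "k \<le> n" if "forces t T P (Suc n) P u" for n
      unfolding k_def by (rule Least_le[of "\<lambda>n. forces t T P (Suc n) P u", OF that])
    ultimately show ?thesis unfolding good_def by (meson forces_mono)
  next
    case False
    with u show ?thesis by (auto simp: good_def stuck_def)
  qed
  define s where "s u = (SOME v. good u v)" for u
  have good: "good u (s u)" if "\<not> stuck t P u" for u
    unfolding s_def using ex[OF that] by (rule someI_ex)
  then have s: "is_strategy t P s" by (auto simp: is_strategy_def good_def)
  have "\<exists>R\<in>T. first_stuck t i x (\<lambda>Q. if Q = P then s else s') = Some R"
    if s': "is_strategy t (opponent P) s'" for s'
  proof -
    define S where "S Q = (if Q = P then s else s')" for Q
    define w where "w = play i x S"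
    have "\<exists>m\<ge>k. stuck_at t i x S m \<and> (\<forall>j. k \<le> j \<and> j < m \<longrightarrow> \<not> stuck_at t i x S j) \<and> mover i m \<in> T"
      if "forces t T P n (mover i k) (w k)" for n k
      using that
    proof (induction n arbitrary: k)
      case 0
      then show ?case by (auto simp: stuck_at_def w_def)
    next
      case (Suc n)
      show ?case
      proof (cases "stuck_at t i x S k")
        case True
        with Suc.prems have "mover i k \<in> T" by (auto simp: stuck_at_def w_def)
        with True show ?thesis by auto
      next
        case False
        then have ns: "\<not> stuck t (mover i k) (w k)" by (simp add: stuck_at_def w_def)
        have "forces t T P n (mover i (Suc k)) (w (Suc k))"
        proof (cases "mover i k = P")
          case True
          with good[of "w k"] ns Suc.prems
          have "forces t T P n (opponent P) (s (w k))" by (auto simp del: forces.simps simp: good_def)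
          then show ?thesis by (simp add: mover_Suc True w_def S_def)
        next
          case False
          then have m: "mover i k = opponent P" by (simp add: neq_opponent_iff)
          with s' ns have "legal t (opponent P) (w k) (s' (w k))" by (simp add: is_strategy_def)
          with Suc.prems ns m show ?thesis by (simp add: mover_Suc w_def S_def)
        qed
        from Suc.IH[OF this] obtain m where "m \<ge> Suc k" "stuck_at t i x S m" "mover i m \<in> T"
          and m: "\<And>j. Suc k \<le> j \<Longrightarrow> j < m \<Longrightarrow> \<not> stuck_at t i x S j" by blast
        moreover have "\<not> stuck_at t i x S j" if "k \<le> j" "j < m" for j
          using m[of j] False that by (cases "j = k") auto
        ultimately show ?thesis by (intro exI[of _ m]) auto
      qed
    qed
    moreover have "mover i 0 = i" "w 0 = x" by (simp_all add: mover_def w_def)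
    ultimately obtain m where "stuck_at t i x S m" "\<forall>j<m. \<not> stuck_at t i x S j" "mover i m \<in> T"
      using assms by (metis le0)
    then have "\<exists>R\<in>T. first_stuck t i x S = Some R"
      unfolding first_stuck_eq_Some_iff by blast
    then show ?thesis by (simp add: S_def[abs_def])
  qed
  with s show ?thesis by blast
qed

text \<open>
  The opponent survives by moving to positions from which no budget suffices. Such a move exists because
  the tree is finitely branching: winning budgets for all children would have a maximum, which would be
  a winning budget, after one more move, for the parent.
\<close>

lemma not_forces_imp_strategy:
  assumes "\<And>n. \<not> forces t T P n i x"
  shows "\<exists>s'. is_strategy t (opponent P) s' \<and> (\<forall>s. is_strategy t P s \<longrightarrow>
    (\<forall>R\<in>T. first_stuck t i x (\<lambda>Q. if Q = P then s else s') \<noteq> Some R))"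
proof -
  let ?O = "opponent P"
  define good where "good u v \<longleftrightarrow> legal t ?O u v \<and>
    ((\<forall>n. \<not> forces t T P n ?O u) \<longrightarrow> (\<forall>n. \<not> forces t T P n P v))" for u v
  have ex: "\<exists>v. good u v" if u: "\<not> stuck t ?O u" for u
  proof (rule ccontr)
    assume no: "\<nexists>v. good u v"
    have "\<exists>n. forces t T P n P v" if "legal t ?O u v" for v
      using no that by (auto simp: good_def)
    then obtain N where N: "\<And>v. legal t ?O u v \<Longrightarrow> forces t T P (N v) P v" by metis
    have "forces t T P (max (N (False # u)) (N (True # u))) P v" if "legal t ?O u v" for v
    proof -
      from that obtain b where "v = b # u" by (auto simp: legal_def edge_def)
      with N[OF that] show ?thesis by (cases b) (auto elim!: forces_mono[rotated])
    qed
    with u have "forces t T P (Suc (max (N (False # u)) (N (True # u)))) ?O u" by auto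
    moreover from u obtain v where "legal t ?O u v" by (auto simp: stuck_def)
    ultimately show False using no by (auto simp: good_def simp del: forces.simps)
  qed
  define s' where "s' u = (SOME v. good u v)" for u
  have good: "good u (s' u)" if "\<not> stuck t ?O u" for u
    unfolding s'_def using ex[OF that] by (rule someI_ex)
  then have s': "is_strategy t ?O s'" by (auto simp: is_strategy_def good_def)
  have "first_stuck t i x (\<lambda>Q. if Q = P then s else s') \<noteq> Some R"
    if s: "is_strategy t P s" and R: "R \<in> T" for s R
  proof
    define S where "S Q = (if Q = P then s else s')" for Q
    define w where "w = play i x S"
    assume "first_stuck t i x (\<lambda>Q. if Q = P then s else s') = Some R"
    then obtain m where m: "stuck_at t i x S m" "R = mover i m"
      and before: "\<And>j. j < m \<Longrightarrow> \<not> stuck_at t i x S j"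
      unfolding first_stuck_eq_Some_iff S_def[abs_def] by blast
    have "\<forall>n. \<not> forces t T P n (mover i k) (w k)" if "k \<le> m" for k
      using that
    proof (induction k)
      case 0
      then show ?case using assms by (simp add: mover_def w_def)
    next
      case (Suc k)
      then have IH: "\<forall>n. \<not> forces t T P n (mover i k) (w k)" by simp
      have ns: "\<not> stuck t (mover i k) (w k)"
        using before[of k] Suc.prems by (simp add: stuck_at_def w_def)
      show ?case
      proof (cases "mover i k = P")
        case True
        with s ns have "legal t P (w k) (s (w k))" by (simp add: is_strategy_def)
        with IH[rule_format, of "Suc _"] True ns show ?thesis
          by (auto simp: mover_Suc w_def S_def)
      next
        case False
        then have "mover i k = ?O" by (simp add: neq_opponent_iff)
        with good[of "w k"] ns IH show ?thesis
          by (auto simp: mover_Suc w_def S_def good_def)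
      qed
    qed
    from this[of m] have "\<not> forces t T P 0 (mover i m) (w m)" by blast
    with m R show False by (simp add: stuck_at_def w_def)
  qed
  with s' show ?thesis by blast
qed

text \<open>
  Determinacy of the games: the player with the reachability objective \<open>T\<close> wins if and only if some
  finite budget suffices. This replaces the quantification over strategies by a condition on finitely
  many vertices at a time.
\<close>

lemma wins_iff_forces:
  assumes W: "\<And>r. W P r \<longleftrightarrow> (\<exists>R\<in>T. r = Some R)"
  shows "wins W t i x P \<longleftrightarrow> (\<exists>n. forces t T P n i x)"
proof
  assume "wins W t i x P"
  then obtain s where s: "is_strategy t P s" and win: "\<And>s'. is_strategy t (opponent P) s' \<Longrightarrow>
      W P (first_stuck t i x (\<lambda>Q. if Q = P then s else s'))"
    unfolding wins_def by blast
  show "\<exists>n. forces t T P n i x"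
  proof (rule ccontr)
    assume "\<nexists>n. forces t T P n i x"
    then obtain s' where "is_strategy t (opponent P) s'"
      "\<And>R. R \<in> T \<Longrightarrow> first_stuck t i x (\<lambda>Q. if Q = P then s else s') \<noteq> Some R"
      using not_forces_imp_strategy[of t T P i x] s by blast
    with win W show False by blast
  qed
next
  assume "\<exists>n. forces t T P n i x"
  then show "wins W t i x P"
    using forces_imp_strategy[of t T P _ i x] unfolding wins_def W by blast
qed

lemma wins_escape_P2_iff: "wins escape t i x P2 \<longleftrightarrow> (\<forall>n. \<not> forces t UNIV P1 n i x)"
proof
  assume "wins escape t i x P2"
  then obtain s where s: "is_strategy t P2 s" and win: "\<And>s'. is_strategy t P1 s' \<Longrightarrow>
      first_stuck t i x (\<lambda>Q. if Q = P2 then s else s') = None"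
    unfolding wins_def escape_def by auto
  show "\<forall>n. \<not> forces t UNIV P1 n i x"
  proof (intro allI notI)
    fix n assume "forces t UNIV P1 n i x"
    then obtain s' R where s': "is_strategy t P1 s'"
      and "first_stuck t i x (\<lambda>Q. if Q = P1 then s' else s) = Some R"
      using forces_imp_strategy[of t UNIV P1 n i x] s by fastforce
    moreover have "(\<lambda>Q. if Q = P1 then s' else s) = (\<lambda>Q. if Q = P2 then s else s')"
      by (rule ext) (rule if_player_swap)
    ultimately show False using win[OF s'] by simp
  qed
next
  assume "\<forall>n. \<not> forces t UNIV P1 n i x"
  then obtain s where s: "is_strategy t P2 s" and win: "\<And>s' R. is_strategy t P1 s' \<Longrightarrow>
      first_stuck t i x (\<lambda>Q. if Q = P1 then s' else s) \<noteq> Some R"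
    using not_forces_imp_strategy[of t UNIV P1 i x] by auto
  moreover have "(\<lambda>Q. if Q = P1 then s' else s) = (\<lambda>Q. if Q = P2 then s else s')" for s' :: strategy
    by (rule ext) (rule if_player_swap)
  ultimately show "wins escape t i x P2"
    by (force simp: wins_def escape_def)
qed

lemma draw_normal_iff:
  "draw normal t i x \<longleftrightarrow>
     (\<forall>n. \<not> forces t {P2} P1 n i x) \<and> (\<forall>n. \<not> forces t {P1} P2 n i x)"
proof -
  have "wins normal t i x P1 \<longleftrightarrow> (\<exists>n. forces t {P2} P1 n i x)"
    by (rule wins_iff_forces) (simp add: normal_def)
  moreover have "wins normal t i x P2 \<longleftrightarrow> (\<exists>n. forces t {P1} P2 n i x)"
    by (rule wins_iff_forces) (simp add: normal_def)
  ultimately show ?thesis unfolding draw_def by (metis player.exhaust)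
qed

lemma draw_misere_iff:
  "draw misere t i x \<longleftrightarrow>
     (\<forall>n. \<not> forces t {P1} P1 n i x) \<and> (\<forall>n. \<not> forces t {P2} P2 n i x)"
proof -
  have "wins misere t i x P1 \<longleftrightarrow> (\<exists>n. forces t {P1} P1 n i x)"
    by (rule wins_iff_forces) (simp add: misere_def)
  moreover have "wins misere t i x P2 \<longleftrightarrow> (\<exists>n. forces t {P2} P2 n i x)"
    by (rule wins_iff_forces) (simp add: misere_def)
  ultimately show ?thesis unfolding draw_def by (metis player.exhaust)
qed


section \<open>Infinite plays\<close>

fun flip :: "colour \<Rightarrow> colour" where
  "flip Blue = Red"
| "flip Red = Blue"

text \<open>
  The mover and the colour of the current vertex determine the colour of the next one. The pairs of
  mover and colour are thus visited in the cyclic order \<open>(P1, Blue)\<close>, \<open>(P2, Blue)\<close>, \<open>(P1, Red)\<close>, \<open>(P2, Red)\<close>.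
\<close>

definition target :: "player \<Rightarrow> colour \<Rightarrow> colour" where
  "target Q c = (case Q of P1 \<Rightarrow> c | P2 \<Rightarrow> flip c)"

text \<open>
  \<open>survives \<eta> n Q u c\<close>: from the vertex \<open>u\<close>, supposed to have colour \<open>c\<close>, the token can be moved \<open>n\<close> times
  if both players cooperate. It refers to the family of broods only and not to the tree, so that it
  makes sense, and depends on the broods below \<open>u\<close> alone, whether or not \<open>u\<close> is a vertex of the tree.
\<close>

primrec survives ::
    "(vertex \<times> colour \<Rightarrow> brood) \<Rightarrow> nat \<Rightarrow> player \<Rightarrow> vertex \<Rightarrow> colour \<Rightarrow> bool" where
  "survives \<eta> 0 Q u c \<longleftrightarrow> True"
| "survives \<eta> (Suc n) Q u c \<longleftrightarrow> (\<exists>i. child_colour (\<eta> (u, c)) i = Some (target Q c) \<and>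
     survives \<eta> n (opponent Q) (i # u) (target Q c))"

lemma legal_iff_target:
  assumes "t u = Some c"
  shows "legal t Q u v \<longleftrightarrow> (\<exists>i. v = i # u) \<and> t v = Some (target Q c)"
proof (cases "t v")
  case None
  then show ?thesis by (simp add: legal_def edge_def)
next
  case (Some c')
  with assms show ?thesis
    by (cases Q; cases c; cases c') (simp_all add: legal_def edge_def target_def)
qed

lemma legal_gw_tree_iff:
  assumes "gw_tree \<omega> u = Some c"
  shows "legal (gw_tree \<omega>) Q u v \<longleftrightarrow>
    (\<exists>i. v = i # u \<and> child_colour (snd \<omega> (u, c)) i = Some (target Q c))"
proof -
  have "gw_tree \<omega> (i # u) = child_colour (snd \<omega> (u, c)) i" for i
    using assms by simp
  then show ?thesis
    unfolding legal_iff_target[where t = "gw_tree \<omega>", OF assms] by metis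
qed

text \<open>
  If every play is over after at most \<open>n\<close> moves, backward induction decides the game: one of the two
  players forces the first stuck player to be in, respectively outside, \<open>T\<close>.
\<close>

lemma forces_if_not_survives:
  assumes "gw_tree \<omega> u = Some c" "\<not> survives (snd \<omega>) n Q u c"
  shows "forces (gw_tree \<omega>) T P n Q u \<or> forces (gw_tree \<omega>) (- T) (opponent P) n Q u"
  using assms
proof (induction n arbitrary: Q u c)
  case 0
  then show ?case by simp
next
  case (Suc n)
  let ?t = "gw_tree \<omega>"
  show ?case
  proof (cases "stuck ?t Q u")
    case True
    then show ?thesis by simp
  next
    case False
    have *: "forces ?t T P n (opponent Q) v \<or> forces ?t (- T) (opponent P) n (opponent Q) v"
      if v: "legal ?t Q u v" for v
    proof -
      from v obtain i where i: "v = i # u" "child_colour (snd \<omega> (u, c)) i = Some (target Q c)"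
        by (auto simp: legal_gw_tree_iff[OF Suc.prems(1)])
      with Suc.prems have "gw_tree \<omega> v = Some (target Q c)"
        "\<not> survives (snd \<omega>) n (opponent Q) v (target Q c)" by auto
      then show ?thesis by (rule Suc.IH)
    qed
    from False obtain v where v: "legal ?t Q u v" by (auto simp: stuck_def)
    consider "Q = P" | "Q = opponent P" by (cases P; cases Q; simp)
    then show ?thesis
    proof cases
      case 1
      with * False show ?thesis by (simp, blast)
    next
      case 2
      with * False show ?thesis by (simp, blast)
    qed
  qed
qed

lemma survives_if_draw_normal:
  assumes "draw normal (gw_tree \<omega>) i []"
  shows "survives (snd \<omega>) n i [] (fst \<omega>)"
  using assms forces_if_not_survives[of \<omega> "[]" "fst \<omega>" n i "{P2}" P1]
  by (simp add: draw_normal_iff Compl_player) blast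

lemma survives_if_draw_misere:
  assumes "draw misere (gw_tree \<omega>) i []"
  shows "survives (snd \<omega>) n i [] (fst \<omega>)"
  using assms forces_if_not_survives[of \<omega> "[]" "fst \<omega>" n i "{P1}" P1]
  by (simp add: draw_misere_iff Compl_player) blast

text \<open>
  In the escape game Stopper has the objective \<open>T = UNIV\<close>. Its complement cannot be forced, so the
  alternative given by \<open>forces_if_not_survives\<close> always falls to Stopper.
\<close>

lemma not_forces_empty: "\<not> forces t {} P n Q u"
proof (induction n arbitrary: Q u)
  case (Suc n)
  show ?case
  proof (cases "stuck t Q u")
    case False
    then obtain v where "legal t Q u v" by (auto simp: stuck_def)
    with False Suc show ?thesis by (simp, blast)
  qed simp
qed simp

lemma survives_if_wins_escape:
  assumes "wins escape (gw_tree \<omega>) i [] P2"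
  shows "survives (snd \<omega>) n i [] (fst \<omega>)"
  using assms forces_if_not_survives[of \<omega> "[]" "fst \<omega>" n i UNIV P1]
  by (simp add: wins_escape_P2_iff not_forces_empty) blast

text \<open>In a tree where every vertex has a child of each colour, nobody is ever stuck.\<close>

lemma not_forces_if_all_One_Each:
  assumes full: "\<And>x. snd \<omega> x = One_Each" and "gw_tree \<omega> u = Some c"
  shows "\<not> forces (gw_tree \<omega>) T P n Q u"
proof -
  let ?t = "gw_tree \<omega>"
  have child: "\<exists>i. child_colour One_Each i = Some c'" for c'
    by (rule exI[of _ "c' = Red"], cases c') auto
  have not_stuck: "\<not> stuck ?t Q u" if "?t u = Some c" for Q u c
    using child by (simp add: stuck_def legal_gw_tree_iff[OF that] full)
  show ?thesis
    using assms(2)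
  proof (induction n arbitrary: Q u c)
    case 0
    then show ?case by (simp add: not_stuck)
  next
    case (Suc n)
    have "\<not> forces ?t T P n (opponent Q) v" if "legal ?t Q u v" for v
    proof (rule Suc.IH)
      from that obtain i where "v = i # u" "child_colour (snd \<omega> (u, c)) i = Some (target Q c)"
        unfolding legal_gw_tree_iff[OF Suc.prems] by blast
      with Suc.prems show "?t v = Some (target Q c)" by simp
    qed
    with not_stuck[OF Suc.prems] show ?case by (auto simp: stuck_def)
  qed
qed


section \<open>The fixed point equations\<close>

lemma mean_product_eq:
  fixes a x y :: real
  shows "(a + 2 * x) * (a + 2 * y) = (a + x + y)^2 - (x - y)^2"
  by (simp add: power2_eq_square algebra_simps)

text \<open>
  The survival probabilities of the four pairs of mover and colour solve this system. A positive solution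
  would make the product of the four quotients \<open>d0 / d1\<close>, \<open>d1 / d2\<close>, \<open>d2 / d3\<close>, \<open>d3 / d0\<close> equal to 1. But
  \<open>(d0 / d1) (d1 / d2) \<le> (a + 2 x) (a + 2 y) \<le> (a + x + y)\<^sup>2 \<le> 1\<close>, and the quadratic terms make the first
  inequality strict unless \<open>x = y = 0\<close>, in which case the bound is \<open>a\<^sup>2\<close>; the same holds for the other two
  quotients with \<open>b\<close>, \<open>u\<close>, \<open>v\<close>.
\<close>

lemma cyclic_system_zero:
  fixes a x y b u v :: real
  assumes pos: "0 \<le> a" "0 \<le> x" "0 \<le> y" "0 \<le> b" "0 \<le> u" "0 \<le> v"
    and sums: "a + x + y \<le> 1" "b + u + v \<le> 1" and nontrivial: "\<not> (a = 1 \<and> b = 1)"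
    and d: "0 \<le> d0" "0 \<le> d1" "0 \<le> d2" "0 \<le> d3"
    and eqs: "d0 = a * d1 + x * (2 * d1 - d1^2)" "d1 = a * d2 + y * (2 * d2 - d2^2)"
      "d2 = b * d3 + u * (2 * d3 - d3^2)" "d3 = b * d0 + v * (2 * d0 - d0^2)"
  shows "d0 = 0 \<and> d1 = 0 \<and> d2 = 0 \<and> d3 = 0"
proof (rule ccontr)
  assume nz: "\<not> ?thesis"
  have "d0 = 0 \<Longrightarrow> d3 = 0" "d3 = 0 \<Longrightarrow> d2 = 0" "d2 = 0 \<Longrightarrow> d1 = 0" "d1 = 0 \<Longrightarrow> d0 = 0"
    by (subst eqs, simp)+
  with nz d have dpos: "0 < d0" "0 < d1" "0 < d2" "0 < d3" unfolding less_le by metis+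
  have "p * e + r * (2 * e - e^2) = (p + 2 * r - r * e) * e" for p r e :: real
    by (simp add: algebra_simps power2_eq_square)
  note F = eqs[unfolded this]
  define f0 f1 f2 f3 where "f0 = a + 2 * x - x * d1" and "f1 = a + 2 * y - y * d2"
    and "f2 = b + 2 * u - u * d3" and "f3 = b + 2 * v - v * d0"
  note f = f0_def f1_def f2_def f3_def
  have "d0 = f0 * (f1 * (f2 * (f3 * d0)))"
    using F[folded f] by metis
  then have "d0 * ((f0 * f1) * (f2 * f3)) = d0 * 1" by (simp add: ac_simps)
  then have prod1: "(f0 * f1) * (f2 * f3) = 1" using dpos by simp
  have fpos: "0 < f0" "0 < f1" "0 < f2" "0 < f3"
    using F[folded f] dpos by (metis zero_less_mult_pos2)+
  \<comment> \<open>\<open>g\<close> and \<open>h\<close> are two consecutive quotients, which share the brood law \<open>p\<close>, \<open>r\<close>, \<open>s\<close>.\<close>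
  have pair: "g * h \<le> 1 \<and> (g * h = 1 \<longrightarrow> p = 1)"
    if "0 \<le> p" "0 \<le> r" "0 \<le> s" "p + r + s \<le> 1" "0 < g" "0 < h" "0 < e" "0 < e'"
      and g: "g = p + 2 * r - r * e" and h: "h = p + 2 * s - s * e'" for p r s g h e e' :: real
  proof -
    have le: "g \<le> p + 2 * r" "h \<le> p + 2 * s" using that by simp_all
    then have "g * h \<le> (p + 2 * r) * (p + 2 * s)" using that by (intro mult_mono) auto
    also have "\<dots> = (p + r + s)^2 - (r - s)^2" by (rule mean_product_eq)
    finally have gh: "g * h \<le> (p + r + s)^2 - (r - s)^2" .
    have sq: "(p + r + s)^2 \<le> 1" using that by (intro power_le_one) auto
    have "p = 1" if gh1: "g * h = 1"
    proof -
      have "(r - s)^2 \<le> 0" using gh gh1 sq by linarith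
      then have rs: "r = s" by simp
      with gh gh1 have "1 \<le> (p + r + s)^2" by simp
      moreover have "(p + r + s)^2 < 1^2" if "p + r + s < 1"
        using that \<open>0 \<le> p\<close> \<open>0 \<le> r\<close> \<open>0 \<le> s\<close> by (intro power_strict_mono) auto
      ultimately have sum: "p + r + s = 1" using \<open>p + r + s \<le> 1\<close> by force
      have one: "p + 2 * r = 1" "p + 2 * s = 1" using rs sum by simp_all
      have "g \<ge> 1"
      proof (rule ccontr)
        assume "\<not> g \<ge> 1"
        then have "g * h < 1 * 1" using le one \<open>0 < g\<close> \<open>0 < h\<close> by (intro mult_less_le_imp_less) auto
        with gh1 show False by simp
      qed
      with g one have "r * e \<le> 0" by simp
      with \<open>0 < e\<close> \<open>0 \<le> r\<close> have "r = 0" by (simp add: mult_le_0_iff)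
      with one show ?thesis by simp
    qed
    moreover have "g * h \<le> 1" using gh sq zero_le_power2[of "r - s"] by linarith
    ultimately show ?thesis by blast
  qed
  note 1 = pair[OF pos(1-3) sums(1) fpos(1,2) dpos(2,3) f0_def f1_def]
  note 2 = pair[OF pos(4-6) sums(2) fpos(3,4) dpos(4,1) f2_def f3_def]
  have "f0 * f1 * (f2 * f3) \<le> f0 * f1 * 1" "f0 * f1 * (f2 * f3) \<le> 1 * (f2 * f3)"
    using 1 2 fpos by (intro mult_left_mono mult_right_mono; simp)+
  then have "f0 * f1 = 1" "f2 * f3 = 1" using prod1 1 2 by linarith+
  with 1 2 nontrivial show False by simp
qed


section \<open>Survival probabilities\<close>

definition broods :: "(colour \<Rightarrow> brood pmf) \<Rightarrow> (vertex \<times> colour \<Rightarrow> brood) measure" where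
  "broods K = (\<Pi>\<^sub>M x\<in>UNIV. measure_pmf (K (snd x)))"

definition below :: "vertex \<Rightarrow> (vertex \<times> colour) set" where
  "below u = {(w @ u, c) | w c. True}"

lemma finite_brood: "finite (UNIV :: brood set)"
  by (simp add: UNIV_brood)

lemma prob_space_broods: "prob_space (broods K)"
  unfolding broods_def by (intro prob_space_PiM measure_pmf.prob_space_axioms)

lemma space_broods [simp]: "space (broods K) = UNIV"
  by (auto simp: broods_def space_PiM)

lemma measurable_brood:
  assumes "x \<in> J"
  shows "(\<lambda>\<eta>. \<eta> x) \<in> measurable (\<Pi>\<^sub>M x\<in>J. measure_pmf (K (snd x))) (count_space UNIV)"
proof -
  have "(\<lambda>\<eta>. \<eta> x) \<in> measurable (\<Pi>\<^sub>M x\<in>J. measure_pmf (K (snd x))) (measure_pmf (K (snd x)))"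
    using assms by (rule measurable_component_singleton)
  then show ?thesis by (simp cong: measurable_cong_sets)
qed

lemma self_in_below: "(u, c) \<in> below u"
  unfolding below_def by (auto intro: exI[of _ "[]"])

lemma below_Cons: "below (i # u) \<subseteq> below u"
proof
  fix x assume "x \<in> below (i # u)"
  then obtain w c where "x = (w @ i # u, c)" by (auto simp: below_def)
  then have "x = ((w @ [i]) @ u, c)" by simp
  then show "x \<in> below u" unfolding below_def by blast
qed

lemma below_siblings_disjoint: "i \<noteq> j \<Longrightarrow> below (i # u) \<inter> below (j # u) = {}"
proof -
  have "v = w" if "v @ i # u = w @ j # u" for v w :: vertex
  proof -
    from that have "length v = length w" by (metis add_right_cancel length_Cons length_append)
    with that show ?thesis by simp
  qed
  then show "i \<noteq> j \<Longrightarrow> below (i # u) \<inter> below (j # u) = {}"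
    by (fastforce simp: below_def)
qed

lemma self_notin_below_Cons: "(u, c) \<notin> below (i # u)"
proof
  assume "(u, c) \<in> below (i # u)"
  then obtain w where "u = w @ i # u" by (auto simp: below_def)
  then have "length u = length (w @ i # u)" by simp
  then show False by simp
qed

lemma survives_cong:
  assumes "\<And>x. x \<in> below u \<Longrightarrow> \<eta> x = \<eta>' x"
  shows "survives \<eta> n Q u c = survives \<eta>' n Q u c"
  using assms
proof (induction n arbitrary: Q u c)
  case (Suc n)
  have "survives \<eta> n (opponent Q) (i # u) (target Q c) = survives \<eta>' n (opponent Q) (i # u) (target Q c)" for i
    using Suc.prems below_Cons by (intro Suc.IH) blast
  moreover have "\<eta> (u, c) = \<eta>' (u, c)" using Suc.prems self_in_below by blast
  ultimately show ?case by simp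
qed simp

lemma survives_antimono: "survives \<eta> (Suc n) Q u c \<Longrightarrow> survives \<eta> n Q u c"
proof (induction n arbitrary: Q u c)
  case (Suc n)
  then show ?case by (subst survives.simps(2)) (metis survives.simps(2))
qed simp

text \<open>
  The index set \<open>J\<close> is kept general: \<open>J = UNIV\<close> gives events of the whole space, \<open>J = below u\<close> events of the
  factor belonging to one subtree, as needed for independence.
\<close>

lemma measurable_survives:
  assumes "below u \<subseteq> J"
  shows "Measurable.pred (\<Pi>\<^sub>M x\<in>J. measure_pmf (K (snd x))) (\<lambda>\<eta>. survives \<eta> n Q u c)"
  using assms
proof (induction n arbitrary: Q u c)
  case 0
  then show ?case by simp
next
  case (Suc n)
  let ?M = "\<Pi>\<^sub>M x\<in>J. measure_pmf (K (snd x))"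
  have "(\<lambda>\<eta>. \<eta> (u, c)) \<in> measurable ?M (count_space UNIV)"
    using Suc.prems self_in_below by (intro measurable_brood) blast
  then have 1: "Measurable.pred ?M (\<lambda>\<eta>. child_colour (\<eta> (u, c)) i = Some (target Q c))" for i
    by (rule measurable_compose) simp
  have 2: "Measurable.pred ?M (\<lambda>\<eta>. survives \<eta> n (opponent Q) (i # u) (target Q c))" for i
    using Suc.prems below_Cons by (intro Suc.IH) blast
  show ?case
    unfolding survives.simps by (intro pred_intros_countable pred_intros_logic 1 2)
qed

lemma indep_vars_broods:
  "prob_space.indep_vars (broods K) (\<lambda>x. measure_pmf (K (snd x))) (\<lambda>x \<eta>. \<eta> x) UNIV"
proof -
  interpret prob_space "broods K" by (rule prob_space_broods)
  have comp: "(\<lambda>\<eta>. \<eta> x) \<in> measurable (broods K) (measure_pmf (K (snd x)))" for x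
    unfolding broods_def by (rule measurable_component_singleton) simp
  have "distr (broods K) (broods K) (\<lambda>\<eta>. \<eta>) = broods K" by (rule distr_id)
  moreover have "distr (broods K) (measure_pmf (K (snd x))) (\<lambda>\<eta>. \<eta> x) = measure_pmf (K (snd x))" for x
    unfolding broods_def by (rule distr_PiM_component) (auto intro: measure_pmf.prob_space_axioms)
  ultimately show ?thesis
    by (subst indep_vars_iff_distr_eq_PiM'[OF _ comp]) (simp_all add: restrict_UNIV broods_def[symmetric])
qed

definition slots :: "brood \<Rightarrow> colour \<Rightarrow> bool set" where
  "slots b c = {i. child_colour b i = Some c}"

text \<open>
  The survival function of the multitype branching process whose types are the pairs of mover and colour
  and whose offspring are the legal moves. The number of legal moves out of \<open>(Q, c)\<close> has the generating
  function \<open>s \<mapsto> (\<Sum>b. pmf (K c) b * s ^ card (slots b (target Q c)))\<close>.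
\<close>

primrec survival :: "(colour \<Rightarrow> brood pmf) \<Rightarrow> nat \<Rightarrow> player \<Rightarrow> colour \<Rightarrow> real" where
  "survival K 0 Q c = 1"
| "survival K (Suc n) Q c = 1 - (\<Sum>b\<in>UNIV. pmf (K c) b *
     (1 - survival K n (opponent Q) (target Q c)) ^ card (slots b (target Q c)))"

text \<open>
  The brood of \<open>u\<close> and the events of survival below its two child slots depend on disjoint sets of
  coordinates, hence are independent; conditioning on the brood gives the recursion. The
  probability is the same for all \<open>u\<close>, since the law of a brood depends on the colour only.
\<close>

lemma prob_survives:
  "measure (broods K) {\<eta>. survives \<eta> n Q u c} = survival K n Q c"
proof (induction n arbitrary: Q u c)
  case 0
  interpret prob_space "broods K" by (rule prob_space_broods)
  show ?case using prob_space by simp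
next
  case (Suc n)
  interpret prob_space "broods K" by (rule prob_space_broods)
  let ?c = "target Q c" and ?Q = "opponent Q"
  define e where "e = survival K n ?Q ?c"
  have ms: "Measurable.pred (broods K) (\<lambda>\<eta>. survives \<eta> k R v d)" for k R v d
    unfolding broods_def by (rule measurable_survives) simp
  have ev: "{\<eta>. survives \<eta> k R v d} \<in> events" for k R v d
    using ms[of k R v d] by (simp add: pred_def)
  have dead: "prob {\<eta>. \<not> survives \<eta> n ?Q (i # u) ?c} = 1 - e" for i
    using prob_compl[OF ev[of n ?Q "i # u" ?c]] Suc.IH[of ?Q "i # u" ?c]
    by (simp add: e_def Compl_eq_Diff_UNIV[symmetric] Collect_neg_eq[symmetric])
  have extinct: "prob {\<eta>. \<eta> (u, c) = b \<and> (\<forall>i\<in>slots b ?c. \<not> survives \<eta> n ?Q (i # u) ?c)} =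
      pmf (K c) b * (1 - e) ^ card (slots b ?c)" for b
  proof -
    \<comment> \<open>The index \<open>None\<close> stands for the brood of \<open>u\<close> and \<open>Some i\<close> for the subtree at slot \<open>i\<close>.\<close>
    define A where "A j = (case j of None \<Rightarrow> {(u, c)} | Some i \<Rightarrow> below (i # u))" for j
    define Y where "Y j \<eta> = (case j of None \<Rightarrow> \<eta> (u, c) = b
      | Some i \<Rightarrow> survives \<eta> n ?Q (i # u) ?c)" for j \<eta>
    define J where "J = insert None (Some ` slots b ?c)"
    define B where "B j = {j = None}" for j :: "bool option"
    have "disjoint_family_on A UNIV"
      by (auto simp: disjoint_family_on_def A_def self_notin_below_Cons below_siblings_disjoint
          split: option.splits)
    then have "indep_vars (\<lambda>j. \<Pi>\<^sub>M x\<in>A j. measure_pmf (K (snd x))) (\<lambda>j \<eta>. restrict (\<lambda>x. \<eta> x) (A j)) UNIV"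
      by (intro indep_vars_restrict[OF indep_vars_broods]) auto
    then have "indep_vars (\<lambda>_. count_space UNIV) (\<lambda>j \<eta>. Y j (restrict (\<lambda>x. \<eta> x) (A j))) UNIV"
    proof (rule indep_vars_compose2)
      fix j
      show "Y j \<in> measurable (\<Pi>\<^sub>M x\<in>A j. measure_pmf (K (snd x))) (count_space UNIV)"
      proof (cases j)
        case None
        have "(\<lambda>\<eta>. \<eta> (u, c)) \<in> measurable (\<Pi>\<^sub>M x\<in>A j. measure_pmf (K (snd x))) (count_space UNIV)"
          by (rule measurable_brood) (simp add: None A_def)
        then have "(\<lambda>\<eta>. \<eta> (u, c) = b) \<in> measurable (\<Pi>\<^sub>M x\<in>A j. measure_pmf (K (snd x))) (count_space UNIV)"
          by (rule measurable_compose) simp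
        then show ?thesis by (simp add: None Y_def[abs_def])
      next
        case (Some i)
        then show ?thesis
          using measurable_survives[where u = "i # u" and J = "A j" and K = K and n = n and Q = ?Q and c = ?c]
          by (simp add: Y_def[abs_def] A_def)
      qed
    qed
    moreover have "Y j (restrict (\<lambda>x. \<eta> x) (A j)) = Y j \<eta>" for j \<eta>
      by (cases j) (auto simp: Y_def A_def intro!: survives_cong)
    ultimately have "indep_vars (\<lambda>_. count_space UNIV) Y UNIV" by simp
    then have "prob (\<Inter>j\<in>J. Y j -` B j \<inter> space (broods K)) = (\<Prod>j\<in>J. prob (Y j -` B j \<inter> space (broods K)))"
      by (rule indep_varsD) (auto simp: J_def)
    moreover have "(\<Inter>j\<in>J. Y j -` B j \<inter> space (broods K)) =
        {\<eta>. \<eta> (u, c) = b \<and> (\<forall>i\<in>slots b ?c. \<not> survives \<eta> n ?Q (i # u) ?c)}"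
      by (rule set_eqI) (simp add: J_def B_def Y_def)
    moreover have "(\<Prod>j\<in>J. prob (Y j -` B j \<inter> space (broods K))) =
        prob (Y None -` B None) * (\<Prod>i\<in>slots b ?c. prob (Y (Some i) -` B (Some i)))"
      unfolding J_def by (subst prod.insert) (auto simp: prod.reindex)
    moreover have "prob (Y (Some i) -` B (Some i)) = 1 - e" for i
      using dead[of i] by (simp add: Y_def B_def vimage_def)
    moreover have "prob (Y None -` B None) = pmf (K c) b"
    proof -
      have "measure (distr (broods K) (measure_pmf (K (snd (u, c)))) (\<lambda>\<eta>. \<eta> (u, c))) {b} =
          measure (measure_pmf (K (snd (u, c)))) {b}"
        unfolding broods_def by (subst distr_PiM_component) (auto intro: measure_pmf.prob_space_axioms)
      moreover have "(\<lambda>\<eta>. \<eta> (u, c)) \<in> measurable (broods K) (measure_pmf (K (snd (u, c))))"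
        unfolding broods_def by (rule measurable_component_singleton) simp
      ultimately show ?thesis
        by (simp add: measure_distr pmf.rep_eq Y_def B_def vimage_def)
    qed
    ultimately show ?thesis by simp
  qed
  let ?E = "\<lambda>b. {\<eta>. \<eta> (u, c) = b \<and> (\<forall>i\<in>slots b ?c. \<not> survives \<eta> n ?Q (i # u) ?c)}"
  have "?E b \<in> events" for b
  proof -
    have "(\<lambda>\<eta>. \<eta> (u, c)) \<in> measurable (broods K) (count_space UNIV)"
      unfolding broods_def by (rule measurable_brood) simp
    then have "Measurable.pred (broods K) (\<lambda>\<eta>. \<eta> (u, c) = b)"
      by (rule measurable_compose) simp
    then have "Measurable.pred (broods K) (\<lambda>\<eta>. \<eta> (u, c) = b \<and> (\<forall>i\<in>slots b ?c. \<not> survives \<eta> n ?Q (i # u) ?c))"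
      by (intro pred_intros_logic pred_intros_finite ms) auto
    then show ?thesis by (simp add: pred_def)
  qed
  then have "prob (\<Union>b\<in>UNIV. ?E b) = (\<Sum>b\<in>UNIV. prob (?E b))"
    using finite_brood by (intro finite_measure_finite_Union) (auto simp: disjoint_family_on_def)
  moreover have "(\<Union>b\<in>UNIV. ?E b) = space (broods K) - {\<eta>. survives \<eta> (Suc n) Q u c}"
    by (auto simp: slots_def)
  ultimately have "1 - prob {\<eta>. survives \<eta> (Suc n) Q u c} =
      (\<Sum>b\<in>UNIV. pmf (K c) b * (1 - e) ^ card (slots b ?c))"
    using prob_compl[OF ev[of "Suc n" Q u c]] by (simp only: extinct)
  then show ?case by (simp add: e_def)
qed

fun twins :: "colour \<Rightarrow> brood" where
  "twins Blue = Two_Blue"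
| "twins Red = Two_Red"

lemma survival_Suc:
  "survival K (Suc n) Q c =
     pmf (K c) One_Each * survival K n (opponent Q) (target Q c) +
     pmf (K c) (twins (target Q c)) *
       (2 * survival K n (opponent Q) (target Q c) - (survival K n (opponent Q) (target Q c))^2)"
proof -
  define e where "e = survival K n (opponent Q) (target Q c)"
  have slots: "card (slots b d) = (if b = One_Each then 1 else if b = twins d then 2 else 0)" for b d
  proof -
    have "slots b d = (if b = One_Each then {d = Red} else if b = twins d then UNIV else {})"
      by (cases b; cases d) (auto simp: slots_def)
    then show ?thesis by (simp add: UNIV_bool)
  qed
  have one: "pmf (K c) No_Child + pmf (K c) Two_Blue + pmf (K c) Two_Red + pmf (K c) One_Each = 1"
  proof -
    have "(\<Sum>b\<in>UNIV. pmf (K c) b) = 1" by (rule sum_pmf_eq_1) (simp_all add: UNIV_brood[symmetric] finite_brood)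
    then show ?thesis by (simp add: UNIV_brood add.assoc)
  qed
  have "survival K (Suc n) Q c =
      1 - (\<Sum>b\<in>UNIV. pmf (K c) b * (1 - e) ^ card (slots b (target Q c)))"
    by (simp add: e_def)
  also have "\<dots> = pmf (K c) One_Each * e + pmf (K c) (twins (target Q c)) * (2 * e - e^2)"
    unfolding slots UNIV_brood
    by (cases "target Q c") (use one in \<open>simp_all add: algebra_simps power2_eq_square\<close>)
  finally show ?thesis by (simp only: e_def)
qed

lemma survival_bounds: "0 \<le> survival K n Q c" "survival K (Suc n) Q c \<le> survival K n Q c"
proof -
  interpret prob_space "broods K" by (rule prob_space_broods)
  show "0 \<le> survival K n Q c" by (simp add: prob_survives[of K n Q "[]" c, symmetric])
  have "{\<eta>. survives \<eta> n Q [] c} \<in> events"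
    using measurable_survives[where u = "[]" and J = UNIV and K = K and n = n and Q = Q and c = c]
    by (simp add: pred_def broods_def[symmetric])
  then show "survival K (Suc n) Q c \<le> survival K n Q c"
    unfolding prob_survives[of K _ Q "[]" c, symmetric]
    by (intro finite_measure_mono) (auto dest: survives_antimono simp del: survives.simps)
qed

text \<open>
  The limits exist by monotonicity and inherit the recursion as a system of fixed point equations, whose only
  nonnegative solution is 0.
\<close>

lemma survival_tendsto_0:
  assumes "\<not> (pmf (K Blue) One_Each = 1 \<and> pmf (K Red) One_Each = 1)"
  shows "(\<lambda>n. survival K n Q c) \<longlonglongrightarrow> 0"
proof -
  define L where "L Q c = lim (\<lambda>n. survival K n Q c)" for Q c
  have lim: "(\<lambda>n. survival K n Q c) \<longlonglongrightarrow> L Q c" for Q c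
  proof -
    have "decseq (\<lambda>n. survival K n Q c)"
      by (intro decseq_SucI survival_bounds)
    then have "convergent (\<lambda>n. survival K n Q c)"
      using survival_bounds(1) by (metis convergentI decseq_convergent)
    then show ?thesis by (simp add: L_def convergent_LIMSEQ_iff)
  qed
  have L_nonneg: "0 \<le> L Q c" for Q c
    using lim by (rule LIMSEQ_le_const) (simp add: survival_bounds)
  have L_eq: "L Q c = pmf (K c) One_Each * L (opponent Q) (target Q c) +
      pmf (K c) (twins (target Q c)) * (2 * L (opponent Q) (target Q c) - (L (opponent Q) (target Q c))^2)"
    for Q c
  proof (rule LIMSEQ_unique)
    show "(\<lambda>n. survival K (Suc n) Q c) \<longlonglongrightarrow> L Q c"
      using lim by (rule LIMSEQ_Suc)
    show "(\<lambda>n. survival K (Suc n) Q c) \<longlonglongrightarrow> pmf (K c) One_Each * L (opponent Q) (target Q c) +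
      pmf (K c) (twins (target Q c)) * (2 * L (opponent Q) (target Q c) - (L (opponent Q) (target Q c))^2)"
      unfolding survival_Suc by (intro tendsto_intros lim)
  qed
  have sum: "pmf (K c) One_Each + pmf (K c) Two_Blue + pmf (K c) Two_Red \<le> 1" for c
  proof -
    have "measure (K c) {One_Each, Two_Blue, Two_Red} \<le> 1" by (rule measure_pmf.prob_le_1)
    then show ?thesis by (simp add: measure_measure_pmf_finite add.assoc)
  qed
  note step = L_eq[unfolded target_def]
  have "L P1 Blue = 0 \<and> L P2 Blue = 0 \<and> L P1 Red = 0 \<and> L P2 Red = 0"
  proof (rule cyclic_system_zero)
    show "L P1 Blue = pmf (K Blue) One_Each * L P2 Blue +
        pmf (K Blue) Two_Blue * (2 * L P2 Blue - (L P2 Blue)^2)"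
      using step[of P1 Blue] by simp
    show "L P2 Blue = pmf (K Blue) One_Each * L P1 Red +
        pmf (K Blue) Two_Red * (2 * L P1 Red - (L P1 Red)^2)"
      using step[of P2 Blue] by simp
    show "L P1 Red = pmf (K Red) One_Each * L P2 Red +
        pmf (K Red) Two_Red * (2 * L P2 Red - (L P2 Red)^2)"
      using step[of P1 Red] by simp
    show "L P2 Red = pmf (K Red) One_Each * L P1 Blue +
        pmf (K Red) Two_Blue * (2 * L P1 Blue - (L P1 Blue)^2)"
      using step[of P2 Red] by simp
    show "pmf (K Blue) One_Each + pmf (K Blue) Two_Blue + pmf (K Blue) Two_Red \<le> 1"
      "pmf (K Red) One_Each + pmf (K Red) Two_Red + pmf (K Red) Two_Blue \<le> 1"
      using sum[of Blue] sum[of Red] by simp_all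
  qed (use assms in \<open>simp_all add: L_nonneg\<close>)
  then have "L Q c = 0" by (cases Q; cases c) simp_all
  with lim[of Q c] show ?thesis by simp
qed

lemma AE_dies_out:
  assumes "\<not> (pmf (K Blue) One_Each = 1 \<and> pmf (K Red) One_Each = 1)"
  shows "AE \<eta> in broods K. \<not> (\<forall>n. survives \<eta> n Q u c)"
proof -
  interpret prob_space "broods K" by (rule prob_space_broods)
  have ms: "Measurable.pred (broods K) (\<lambda>\<eta>. survives \<eta> n Q u c)" for n
    unfolding broods_def by (rule measurable_survives) simp
  then have ev: "{\<eta>. survives \<eta> n Q u c} \<in> events" for n
    by (simp add: pred_def)
  have "Measurable.pred (broods K) (\<lambda>\<eta>. \<forall>n. survives \<eta> n Q u c)"
    by (intro pred_intros_countable ms)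
  then have ev_all: "{\<eta>. \<forall>n. survives \<eta> n Q u c} \<in> events"
    by (simp add: pred_def)
  have "prob {\<eta>. \<forall>n. survives \<eta> n Q u c} \<le> survival K n Q c" for n
    unfolding prob_survives[of K n Q u c, symmetric] by (intro finite_measure_mono ev) auto
  then have "prob {\<eta>. \<forall>n. survives \<eta> n Q u c} \<le> 0"
    using survival_tendsto_0[OF assms, of Q c] by (intro LIMSEQ_le_const[of "\<lambda>n. survival K n Q c"]) blast+
  then have "prob {\<eta>. \<forall>n. survives \<eta> n Q u c} = 0"
    by (simp add: measure_le_0_iff)
  with ev_all have "{\<eta>. \<forall>n. survives \<eta> n Q u c} \<in> null_sets (broods K)"
    by (simp add: null_sets_def emeasure_eq_measure)
  then show ?thesis by (rule AE_I') auto
qed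


section \<open>Measurability of the outcomes\<close>

lemma gw_space_eq: "gw_space rho K = measure_pmf rho \<Otimes>\<^sub>M broods K"
  by (simp add: gw_space_def broods_def)

lemma space_gw_space [simp]: "space (gw_space rho K) = UNIV"
  by (simp add: gw_space_eq space_pair_measure)

lemma prob_space_gw_space: "prob_space (gw_space rho K)"
proof -
  interpret N: prob_space "broods K" by (rule prob_space_broods)
  interpret pair_prob_space "measure_pmf rho" "broods K" ..
  show ?thesis unfolding gw_space_eq by (rule prob_space_axioms)
qed

lemma AE_gw_space_snd:
  assumes "AE \<eta> in broods K. R \<eta>"
  shows "AE \<omega> in gw_space rho K. R (snd \<omega>)"
proof -
  interpret N: prob_space "broods K" by (rule prob_space_broods)
  from assms obtain N where N: "N \<in> null_sets (broods K)" "{\<eta>. \<not> R \<eta>} \<subseteq> N"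
    by (auto simp: eventually_ae_filter)
  then have "UNIV \<times> N \<in> null_sets (gw_space rho K)"
    by (auto simp: null_sets_def gw_space_eq N.emeasure_pair_measure_Times)
  then show ?thesis by (rule AE_I') (use N(2) in auto)
qed

lemma prob_root_colour: "measure (gw_space rho K) {\<omega>. fst \<omega> = j} = pmf rho j"
proof -
  interpret N: prob_space "broods K" by (rule prob_space_broods)
  have "{\<omega>. fst \<omega> = j} = {j} \<times> space (broods K)" by auto
  then have "emeasure (gw_space rho K) {\<omega>. fst \<omega> = j} = ennreal (pmf rho j)"
    using N.emeasure_space_1
    by (simp add: gw_space_eq N.emeasure_pair_measure_Times emeasure_pmf_single del: space_broods)
  then show ?thesis by (simp add: measure_def)
qed

lemma measurable_gw_tree: "Measurable.pred (gw_space rho K) (\<lambda>\<omega>. gw_tree \<omega> u = x)"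
proof (induction u arbitrary: x)
  case Nil
  have "fst \<in> measurable (gw_space rho K) (measure_pmf rho)"
    unfolding gw_space_eq by (rule measurable_fst)
  then have "fst \<in> measurable (gw_space rho K) (count_space UNIV)"
    by (simp cong: measurable_cong_sets)
  then have "(\<lambda>\<omega>. Some (fst \<omega>) = x) \<in> measurable (gw_space rho K) (count_space UNIV)"
    by (rule measurable_compose) simp
  then show ?case by simp
next
  case (Cons i u)
  have child: "Measurable.pred (gw_space rho K) (\<lambda>\<omega>. child_colour (snd \<omega> (u, c)) i = x)" for c
  proof -
    have "(\<lambda>\<eta>. \<eta> (u, c)) \<in> measurable (broods K) (count_space UNIV)"
      unfolding broods_def by (rule measurable_brood) simp
    moreover have "snd \<in> measurable (gw_space rho K) (broods K)"
      unfolding gw_space_eq by (rule measurable_snd)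
    ultimately have "(\<lambda>\<omega>. snd \<omega> (u, c)) \<in> measurable (gw_space rho K) (count_space UNIV)"
      by (rule measurable_compose[rotated])
    then show ?thesis by (rule measurable_compose) simp
  qed
  have "gw_tree \<omega> (i # u) = x \<longleftrightarrow> (gw_tree \<omega> u = None \<and> x = None) \<or>
      (gw_tree \<omega> u = Some Blue \<and> child_colour (snd \<omega> (u, Blue)) i = x) \<or>
      (gw_tree \<omega> u = Some Red \<and> child_colour (snd \<omega> (u, Red)) i = x)" for \<omega>
  proof (cases "gw_tree \<omega> u")
    case (Some c)
    then show ?thesis by (cases c) simp_all
  qed auto
  moreover have "Measurable.pred (gw_space rho K) (\<lambda>\<omega>. (gw_tree \<omega> u = None \<and> x = None) \<or>
      (gw_tree \<omega> u = Some Blue \<and> child_colour (snd \<omega> (u, Blue)) i = x) \<or>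
      (gw_tree \<omega> u = Some Red \<and> child_colour (snd \<omega> (u, Red)) i = x))"
    by (intro pred_intros_logic Cons.IH child) simp
  ultimately show ?case by (simp only:)
qed

lemma measurable_forces:
  "Measurable.pred (gw_space rho K) (\<lambda>\<omega>. forces (gw_tree \<omega>) T P n Q u)"
proof (induction n arbitrary: Q u)
  have legal: "legal t Q u (i # u) \<longleftrightarrow> (t u = Some Blue \<and> t (i # u) = Some (target Q Blue)) \<or>
      (t u = Some Red \<and> t (i # u) = Some (target Q Red))" for t Q u i
  proof (cases "t u")
    case None
    then show ?thesis by (simp add: legal_def edge_def)
  next
    case (Some c)
    then show ?thesis by (cases c) (simp_all add: legal_iff_target)
  qed
  have m_legal: "Measurable.pred (gw_space rho K) (\<lambda>\<omega>. legal (gw_tree \<omega>) Q u (i # u))" for Q u i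
    unfolding legal by (intro pred_intros_logic measurable_gw_tree)
  have child: "\<exists>i. v = i # u" if "legal t Q u v" for t Q u v
    using that by (auto simp: legal_def edge_def)
  have ex_legal: "(\<exists>v. legal t Q u v \<and> R v) \<longleftrightarrow> (\<exists>i. legal t Q u (i # u) \<and> R (i # u))"
    and all_legal: "(\<forall>v. legal t Q u v \<longrightarrow> R v) \<longleftrightarrow> (\<forall>i. legal t Q u (i # u) \<longrightarrow> R (i # u))"
    for t Q u R
    using child by blast+
  have "stuck t Q u \<longleftrightarrow> (\<forall>i. \<not> legal t Q u (i # u))" for t Q u
    using all_legal[of t Q u "\<lambda>_. False"] by (simp add: stuck_def)
  then have m_stuck: "Measurable.pred (gw_space rho K) (\<lambda>\<omega>. stuck (gw_tree \<omega>) Q u)" for Q u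
    by (simp only:) (intro pred_intros_countable pred_intros_logic m_legal)
  {
    case 0
    show ?case unfolding forces.simps by (intro pred_intros_logic m_stuck) simp
  next
    case (Suc n)
    have "forces t T P (Suc n) Q u \<longleftrightarrow> (stuck t Q u \<and> Q \<in> T) \<or> (\<not> stuck t Q u \<and>
       ((Q = P \<and> (\<exists>i. legal t Q u (i # u) \<and> forces t T P n (opponent Q) (i # u))) \<or>
        (Q \<noteq> P \<and> (\<forall>i. legal t Q u (i # u) \<longrightarrow> forces t T P n (opponent Q) (i # u)))))" for t
      by (cases "stuck t Q u"; cases "Q = P") (simp_all add: ex_legal all_legal)
    moreover have "Measurable.pred (gw_space rho K) (\<lambda>\<omega>. let t = gw_tree \<omega> in
       (stuck t Q u \<and> Q \<in> T) \<or> (\<not> stuck t Q u \<and>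
       ((Q = P \<and> (\<exists>i. legal t Q u (i # u) \<and> forces t T P n (opponent Q) (i # u))) \<or>
        (Q \<noteq> P \<and> (\<forall>i. legal t Q u (i # u) \<longrightarrow> forces t T P n (opponent Q) (i # u))))))"
      unfolding Let_def
      by (intro pred_intros_countable pred_intros_logic m_legal m_stuck Suc.IH) simp_all
    ultimately show ?case by (simp only: Let_def)
  }
qed

text \<open>
  An outcome is defined by quantifiers over strategies, which say nothing about measurability; the
  description by \<open>forces\<close> is a countable combination of events.
\<close>

lemma measurable_draw_normal: "Measurable.pred (gw_space rho K) (\<lambda>\<omega>. draw normal (gw_tree \<omega>) i x)"
  unfolding draw_normal_iff by (intro pred_intros_countable pred_intros_logic measurable_forces)

lemma measurable_draw_misere: "Measurable.pred (gw_space rho K) (\<lambda>\<omega>. draw misere (gw_tree \<omega>) i x)"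
  unfolding draw_misere_iff by (intro pred_intros_countable pred_intros_logic measurable_forces)

lemma measurable_wins_escape: "Measurable.pred (gw_space rho K) (\<lambda>\<omega>. wins escape (gw_tree \<omega>) i x P2)"
  unfolding wins_escape_P2_iff by (intro pred_intros_countable pred_intros_logic measurable_forces)


section \<open>The probabilities of the outcomes\<close>

text \<open>
  The common shape of the three parts: an event that requires an infinite play, and that occurs whenever
  all broods are \<open>One_Each\<close>, has conditional probability 0 or 1. If \<open>One_Each\<close> is certain for both colours, then
  almost surely all broods are \<open>One_Each\<close>; otherwise infinite plays almost surely do not exist.
\<close>

lemma zero_one_law:
  fixes rho :: "colour pmf" and K :: "colour \<Rightarrow> brood pmf"
  defines "M \<equiv> gw_space rho K"
  assumes meas: "Measurable.pred M E"
    and survives: "\<And>\<omega> n. E \<omega> \<Longrightarrow> survives (snd \<omega>) n Q [] (fst \<omega>)"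
    and full: "\<And>\<omega>. (\<And>x. snd \<omega> x = One_Each) \<Longrightarrow> E \<omega>"
    and pos: "pmf rho j > 0"
  shows "cond_prob M E (\<lambda>\<omega>. gw_tree \<omega> [] = Some j) =
    (if pmf (K Blue) One_Each = 1 \<and> pmf (K Red) One_Each = 1 then 1 else 0)"
proof -
  interpret prob_space M unfolding M_def by (rule prob_space_gw_space)
  have [simp]: "space M = UNIV" by (simp add: M_def)
  have root: "Measurable.pred M (\<lambda>\<omega>. gw_tree \<omega> [] = Some j)"
    unfolding M_def by (rule measurable_gw_tree)
  have prob_root: "prob {\<omega>. fst \<omega> = j} = pmf rho j"
    unfolding M_def by (rule prob_root_colour)
  show ?thesis
  proof (cases "pmf (K Blue) One_Each = 1 \<and> pmf (K Red) One_Each = 1")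
    case True
    have "AE \<eta> in broods K. \<eta> x = One_Each" for x
    proof -
      have "pmf (K (snd x)) One_Each = 1" using True by (cases "snd x") auto
      then have "AE b in measure_pmf (K (snd x)). b \<in> {One_Each}"
        by (intro measure_pmf.AE_prob_1) (simp add: measure_pmf_single)
      then show ?thesis
        unfolding broods_def by (intro AE_PiM_component measure_pmf.prob_space_axioms) auto
    qed
    \<comment> \<open>Colour by colour, so that the quantifier ranges over the countable type of vertices.\<close>
    then have "AE \<eta> in broods K. \<forall>u. \<eta> (u, c) = One_Each" for c
      by (simp add: AE_all_countable)
    from this[of Blue] this[of Red] have "AE \<eta> in broods K. \<forall>x. \<eta> x = One_Each"
    proof eventually_elim
      case (elim \<eta>)
      then show ?case by (metis colour.exhaust surj_pair)
    qed
    from AE_gw_space_snd[OF this] have "AE \<omega> in M. \<forall>x. snd \<omega> x = One_Each"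
      unfolding M_def .
    then have "AE \<omega> in M. E \<omega>" by eventually_elim (auto intro: full)
    then have "cond_prob M E (\<lambda>\<omega>. gw_tree \<omega> [] = Some j) =
        cond_prob M (\<lambda>_. True) (\<lambda>\<omega>. gw_tree \<omega> [] = Some j)"
      using meas root sets.top[of M] by (intro cond_prob_eq_AE) (auto simp: pred_def)
    also have "\<dots> = 1" using prob_root pos by (simp add: cond_prob_def)
    finally show ?thesis using True by simp
  next
    case False
    have "AE \<omega> in M. \<not> (\<forall>n. survives (snd \<omega>) n Q [] Blue)"
      "AE \<omega> in M. \<not> (\<forall>n. survives (snd \<omega>) n Q [] Red)"
      unfolding M_def by (intro AE_gw_space_snd AE_dies_out[OF False])+
    then have "AE \<omega> in M. \<not> E \<omega>"
    proof eventually_elim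
      case (elim \<omega>)
      then show ?case using survives[of \<omega>] by (cases "fst \<omega>") auto
    qed
    then have "cond_prob M E (\<lambda>\<omega>. gw_tree \<omega> [] = Some j) =
        cond_prob M (\<lambda>_. False) (\<lambda>\<omega>. gw_tree \<omega> [] = Some j)"
      using meas root sets.top[of M] by (intro cond_prob_eq_AE) (auto simp: pred_def)
    also have "\<dots> = 0" by (simp add: cond_prob_def)
    finally show ?thesis using False by simp
  qed
qed

theorem theorem1p4:
  fixes p0 pbb prr pbr q0 qbb qrr qbr :: real
    and rho :: "colour pmf"
    and M :: "sample measure"
  assumes "p0 \<ge> 0" "pbb \<ge> 0" "prr \<ge> 0" "pbr \<ge> 0" "p0 + pbb + prr + pbr = 1"
    and "q0 \<ge> 0" "qbb \<ge> 0" "qrr \<ge> 0" "qbr \<ge> 0" "q0 + qbb + qrr + qbr = 1"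
    and "pmf rho Blue > 0" "pmf rho Red > 0"
    and "M = gw_space rho (\<lambda>c. case c of Blue \<Rightarrow> brood_law p0 pbb prr pbr
                                       | Red \<Rightarrow> brood_law q0 qbb qrr qbr)"
  shows "(\<forall>i. if pbr = 1 \<and> qbr = 1 then nd M i Blue = 1 \<and> nd M i Red = 1
                                    else nd M i Blue = 0 \<and> nd M i Red = 0)
       \<and> (\<forall>i. if pbr = 1 \<and> qbr = 1 then md M i Blue = 1 \<and> md M i Red = 1
                                    else md M i Blue = 0 \<and> md M i Red = 0)
       \<and> (if pbr = 1 \<and> qbr = 1 then esl M Blue = 1 \<and> esl M Red = 1
                                else esl M Blue = 0 \<and> esl M Red = 0)"
proof -
  define K where "K c = (case c of Blue \<Rightarrow> brood_law p0 pbb prr pbr | Red \<Rightarrow> brood_law q0 qbb qrr qbr)" for c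
  have M: "M = gw_space rho K" by (simp add: assms(13) K_def[abs_def])
  have K: "pmf (K Blue) One_Each = pbr" "pmf (K Red) One_Each = qbr"
    using assms(1-10) by (simp_all add: K_def pmf_brood_law)
  have pos: "pmf rho j > 0" for j using assms(11,12) by (cases j) auto
  have no_force: "\<not> forces (gw_tree \<omega>) T P n i []" if "\<And>x. snd \<omega> x = One_Each" for \<omega> T P n i
    using not_forces_if_all_One_Each[OF that] by simp
  have nd: "nd M i j = (if pmf (K Blue) One_Each = 1 \<and> pmf (K Red) One_Each = 1 then 1 else 0)" for i j
    unfolding nd_def M
    by (rule zero_one_law[OF measurable_draw_normal survives_if_draw_normal _ pos])
      (simp_all add: draw_normal_iff no_force)
  have md: "md M i j = (if pmf (K Blue) One_Each = 1 \<and> pmf (K Red) One_Each = 1 then 1 else 0)" for i j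
    unfolding md_def M
    by (rule zero_one_law[OF measurable_draw_misere survives_if_draw_misere _ pos])
      (simp_all add: draw_misere_iff no_force)
  have esl: "esl M j = (if pmf (K Blue) One_Each = 1 \<and> pmf (K Red) One_Each = 1 then 1 else 0)" for j
    unfolding esl_def M
    by (rule zero_one_law[OF measurable_wins_escape survives_if_wins_escape _ pos])
      (simp_all add: wins_escape_P2_iff no_force)
  show ?thesis by (simp add: nd md esl K)
qed

end
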